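(* Let $\Delta\subset\mathbb{R}^2$ be a two-dimensional lattice polytope, let $f=\bigoplus_{I\in\mathbb{Z}(\Delta)}a_I\odot x_1^{\odot i_1}\odot x_2^{\odot i_2}$ be a saturated tropical polynomial with dual complex $\mathcal{P}$, and let $X=V(f)\subset\mathbb{T}^2$ be the corresponding tropical plane curve. Let finitely many fixed points be specified on $X$, each lying in the interior of an edge of $X$. Assume that every $2$-dimensional polytope of $\mathcal{P}$ contains exactly $3$ lattice points. Let $\Gamma$ be the graph whose vertices are all the lattice points of $\Delta$ and whose edges are those edges of $\mathcal{P}$ that are dual to an edge of $X$ containing a fixed point in its interior. Then $X$ is uniquely determined (that is, $X$ is the only $\Delta$-hypersurface containing all the fixed points) if and only if $\Gamma$ is connected.
   Context: $\mathbb{T}$ is the min-plus semiring: the set $\mathbb{R}$ with $a\odot b=a+b$ and $a\oplus b=\min(a,b)$. For a lattice polytope $\Delta\subset\mathbb{R}^n$ put $\mathbb{Z}(\Delta)=\Delta\cap\mathbb{Z}^n$. A tropical polynomial with support in $\Delta$ is a formal sum $f=\bigoplus_{I\in\mathbb{Z}(\Delta)}a_I\odot x_1^{\odot i_1}\odot\cdots\odot x_n^{\odot i_n}$ with $a_I\in\mathbb{T}$. For $\mathbf{y}\in\mathbb{T}^n$ let $B_f(\mathbf{y})\subset\mathbb{Z}(\Delta)$ be the set of $I$ achieving $\min_I\{a_I+\sum_k i_ky_k\}$. The tropical hypersurface ($\Delta$-hypersurface) $V(f)$ is the set of $\mathbf{y}$ with $|B_f(\mathbf{y})|\ge 2$,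 with its natural polyhedral structure. $f$ is saturated if every $I\in\mathbb{Z}(\Delta)$ lies in $B_f(\mathbf{y})$ for some $\mathbf{y}$; every $\Delta$-hypersurface is given by a saturated polynomial, and hypersurfaces $V(f)$ are always given with $f$ saturated. The dual complex of $V(f)$ is the polyhedral decomposition $\mathcal{P}$ of $\Delta$ whose cells are the convex hulls of the sets $B_f(\mathbf{y})$, $\mathbf{y}\in\mathbb{T}^n$. The relative interior of the polyhedron dual to a cell $P\in\mathcal{P}$ is the set of $\mathbf{y}$ whose $B_f(\mathbf{y})$ has convex hull $P$. For $n=2$, edges of $X=V(f)$ are dual to the edges ($1$-dimensional cells) of $\mathcal{P}$. *)

theory Defs
  imports "HOL-Analysis.Analysis" "Graph_Theory.Digraph_Component"
begin

definition integer_points :: "(real ^ 'n) set" where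
  "integer_points = {I. \<forall>k. I $ k \<in> \<int>}"

definition lattice_polytope :: "(real ^ 'n) set \<Rightarrow> bool" where
  "lattice_polytope \<Delta> \<longleftrightarrow> (\<exists>V. finite V \<and> V \<subseteq> integer_points \<and> \<Delta> = convex hull V)"

definition lattice_points :: "(real ^ 'n) set \<Rightarrow> (real ^ 'n) set" where
  "lattice_points \<Delta> = \<Delta> \<inter> integer_points"

text \<open>A tropical polynomial with support in \<open>\<Delta>\<close> is given by its coefficients \<open>a I\<close>, where
  \<open>I\<close> ranges over \<open>lattice_points \<Delta>\<close>; the values of \<open>a\<close> elsewhere are never used.
  Exponent vectors are real vectors with integer entries, so that convex hulls of sets of
  exponents can be formed directly. There is no coefficient \<open>\<infinity>\<close>.\<close>

definition trop_monomial ::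
  "(real ^ 'n \<Rightarrow> real) \<Rightarrow> real ^ 'n \<Rightarrow> real ^ 'n \<Rightarrow> real" where
  "trop_monomial a I y = a I + (\<Sum>k\<in>UNIV. I $ k * y $ k)"

definition trop_eval ::
  "(real ^ 'n) set \<Rightarrow> (real ^ 'n \<Rightarrow> real) \<Rightarrow> real ^ 'n \<Rightarrow> real" where
  "trop_eval \<Delta> a y = Min ((\<lambda>I. trop_monomial a I y) ` lattice_points \<Delta>)"

definition minimizers ::
  "(real ^ 'n) set \<Rightarrow> (real ^ 'n \<Rightarrow> real) \<Rightarrow> real ^ 'n \<Rightarrow> (real ^ 'n) set" where
  "minimizers \<Delta> a y = {I \<in> lattice_points \<Delta>. trop_monomial a I y = trop_eval \<Delta> a y}"

definition saturated :: "(real ^ 'n) set \<Rightarrow> (real ^ 'n \<Rightarrow> real) \<Rightarrow> bool" where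
  "saturated \<Delta> a \<longleftrightarrow> (\<forall>I \<in> lattice_points \<Delta>. \<exists>y. I \<in> minimizers \<Delta> a y)"

definition trop_hypersurface ::
  "(real ^ 'n) set \<Rightarrow> (real ^ 'n \<Rightarrow> real) \<Rightarrow> (real ^ 'n) set" where
  "trop_hypersurface \<Delta> a = {y. card (minimizers \<Delta> a y) \<ge> 2}"

definition is_hypersurface :: "(real ^ 'n) set \<Rightarrow> (real ^ 'n) set \<Rightarrow> bool" where
  "is_hypersurface \<Delta> X \<longleftrightarrow> (\<exists>a. saturated \<Delta> a \<and> X = trop_hypersurface \<Delta> a)"

definition dual_complex ::
  "(real ^ 'n) set \<Rightarrow> (real ^ 'n \<Rightarrow> real) \<Rightarrow> (real ^ 'n) set set" where
  "dual_complex \<Delta> a = range (\<lambda>y. convex hull (minimizers \<Delta> a y))"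

text \<open>The set under the closure is convex and relatively open, so it is the relative interior
  of the closed polyhedron defined here.\<close>

definition dual_polyhedron ::
  "(real ^ 'n) set \<Rightarrow> (real ^ 'n \<Rightarrow> real) \<Rightarrow> (real ^ 'n) set \<Rightarrow> (real ^ 'n) set" where
  "dual_polyhedron \<Delta> a P = closure {y. convex hull (minimizers \<Delta> a y) = P}"

definition dual_complex_edges ::
  "(real ^ 'n) set \<Rightarrow> (real ^ 'n \<Rightarrow> real) \<Rightarrow> (real ^ 'n) set set" where
  "dual_complex_edges \<Delta> a = {E \<in> dual_complex \<Delta> a. aff_dim E = 1}"

definition curve_edges ::
  "(real ^ 2) set \<Rightarrow> (real ^ 2 \<Rightarrow> real) \<Rightarrow> (real ^ 2) set set" where
  "curve_edges \<Delta> a = dual_polyhedron \<Delta> a ` dual_complex_edges \<Delta> a"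

definition marked_edges ::
  "(real ^ 2) set \<Rightarrow> (real ^ 2 \<Rightarrow> real) \<Rightarrow> (real ^ 2) set \<Rightarrow> (real ^ 2) set set" where
  "marked_edges \<Delta> a F =
     {E \<in> dual_complex_edges \<Delta> a. rel_interior (dual_polyhedron \<Delta> a E) \<inter> F \<noteq> {}}"

text \<open>The undirected graph is encoded as a symmetric digraph: a marked edge, which is a
  segment, joins its two endpoints.\<close>

definition marked_graph ::
  "(real ^ 2) set \<Rightarrow> (real ^ 2 \<Rightarrow> real) \<Rightarrow> (real ^ 2) set \<Rightarrow> (real ^ 2) pair_pre_digraph" where
  "marked_graph \<Delta> a F =
     \<lparr>pverts = lattice_points \<Delta>,
      parcs = {(I, J). I \<noteq> J \<and> closed_segment I J \<in> marked_edges \<Delta> a F}\<rparr>"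

end

theory Submission
  imports Defs
begin

text \<open>A point \<open>y\<close> and a polynomial \<open>a\<close> determine the set of exponents minimal at \<open>y\<close>, whose convex hull
  is a cell of the dual complex. Any such set extends to one that spans the whole space
  (\<open>minimizers_subset_full_dim\<close>), and there the hypothesis on lattice points leaves room only for the
  vertices of a simplex. Hence all sets of minimizers are affinely independent, and since the faces
  of a simplex are exposed, every nonempty subset of such a set is again the set of minimizers at some
  point (\<open>minimizers_subset_realized\<close>). At a fixed point exactly two exponents \<open>I\<close>, \<open>J\<close> are minimal,
  and these pairs are the arcs of the graph (\<open>parcs_marked_graph\<close>).

  Suppose the graph is connected and \<open>V(b)\<close> passes through the fixed points. The set of exponents
  where \<open>b - a\<close> is least is closed under arcs: at a fixed point with arc \<open>{I, J}\<close>, if \<open>b - a\<close> were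
  least at \<open>I\<close> but not at \<open>J\<close>, then \<open>I\<close> would be the only minimizer for \<open>b\<close>
  (\<open>least_difference_propagates\<close>). So \<open>b - a\<close> is constant and the two curves agree.

  Suppose the graph is disconnected, and let \<open>S\<close> be a nonempty proper set of exponents that no arc leaves.
  Raising the coefficients in \<open>S\<close> by a small amount affects both minimizers at a fixed point equally,
  so the new curve still passes through it. Every exponent is the unique minimizer at some point, which
  survives a small change, so saturation is kept. Since the plane is connected, some edge of the dual complex
  crosses the cut (\<open>crossing_edge_exists\<close>); there the tie is broken, so the curve has changed
  (\<open>other_hypersurface_exists\<close>).\<close>

section \<open>Minimizing monomials\<close>

lemma finite_lattice_points:
  fixes \<Delta> :: "(real ^ 'n) set"
  assumes "bounded \<Delta>"
  shows "finite (lattice_points \<Delta>)"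
proof -
  obtain r where r: "\<And>x. x \<in> \<Delta> \<Longrightarrow> norm x \<le> r"
    using assms bounded_iff by blast
  let ?A = "{k \<in> \<int>. \<bar>k\<bar> \<le> r}"
  have "x \<in> vec_lambda ` (UNIV \<rightarrow>\<^sub>E ?A)" if "x \<in> lattice_points \<Delta>" for x
  proof (rule image_eqI)
    show "x = vec_lambda (\<lambda>i. x $ i)" by simp
    show "(\<lambda>i. x $ i) \<in> UNIV \<rightarrow>\<^sub>E ?A"
      using that r component_le_norm_cart[of x]
      by (fastforce simp: lattice_points_def integer_points_def intro: order_trans)
  qed
  moreover have "finite (UNIV \<rightarrow>\<^sub>E ?A :: ('n \<Rightarrow> real) set)"
    by (intro finite_PiE finite_abs_int_segment) simp
  ultimately show ?thesis
    by (meson finite_imageI finite_subset subsetI)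
qed

lemma bounded_lattice_polytope: "lattice_polytope \<Delta> \<Longrightarrow> bounded \<Delta>"
  by (auto simp: lattice_polytope_def finite_imp_bounded bounded_convex_hull)

lemma trop_monomial_inner: "trop_monomial a I y = a I + I \<bullet> y"
  by (simp add: trop_monomial_def inner_vec_def)

lemma mem_minimizers_iff:
  assumes "finite (lattice_points \<Delta>)"
  shows "I \<in> minimizers \<Delta> a y \<longleftrightarrow>
    I \<in> lattice_points \<Delta> \<and> (\<forall>K \<in> lattice_points \<Delta>. a I + I \<bullet> y \<le> a K + K \<bullet> y)"
proof (cases "I \<in> lattice_points \<Delta>")
  case True
  then have "trop_eval \<Delta> a y = trop_monomial a I y \<longleftrightarrow>
      (\<forall>K \<in> lattice_points \<Delta>. trop_monomial a I y \<le> trop_monomial a K y)"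
    unfolding trop_eval_def by (subst Min_eq_iff) (use assms in auto)
  then show ?thesis
    using True by (auto simp: minimizers_def trop_monomial_inner)
qed (simp add: minimizers_def)

lemma minimizers_subset: "minimizers \<Delta> a y \<subseteq> lattice_points \<Delta>"
  by (auto simp: minimizers_def)

lemma minimizers_eqI:
  assumes "finite (lattice_points \<Delta>)" and "T \<subseteq> lattice_points \<Delta>" and "T \<noteq> {}"
    and eq: "\<And>I. I \<in> T \<Longrightarrow> a I + I \<bullet> y = m"
    and less: "\<And>K. K \<in> lattice_points \<Delta> - T \<Longrightarrow> m < a K + K \<bullet> y"
  shows "minimizers \<Delta> a y = T"
proof
  obtain I0 where "I0 \<in> T" using assms(3) by blast
  then show "minimizers \<Delta> a y \<subseteq> T"
    using assms(2) eq less by (fastforce simp: mem_minimizers_iff[OF assms(1)])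
  have "m \<le> a K + K \<bullet> y" if "K \<in> lattice_points \<Delta>" for K
    using that eq[of K] less[of K] by (cases "K \<in> T") auto
  then show "T \<subseteq> minimizers \<Delta> a y"
    using assms(2) eq by (auto simp: mem_minimizers_iff[OF assms(1)])
qed

lemma minimum_value_exists:
  assumes "finite (lattice_points \<Delta>)" and "lattice_points \<Delta> \<noteq> {}"
  obtains m where "minimizers \<Delta> a y \<noteq> {}"
    and "\<And>I. I \<in> minimizers \<Delta> a y \<Longrightarrow> a I + I \<bullet> y = m"
    and "\<And>K. K \<in> lattice_points \<Delta> \<Longrightarrow> m \<le> a K + K \<bullet> y"
    and "\<And>K. K \<in> lattice_points \<Delta> - minimizers \<Delta> a y \<Longrightarrow> m < a K + K \<bullet> y"
proof
  let ?m = "trop_eval \<Delta> a y"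
  have "?m \<in> (\<lambda>I. trop_monomial a I y) ` lattice_points \<Delta>"
    unfolding trop_eval_def by (rule Min_in) (use assms in auto)
  then show "minimizers \<Delta> a y \<noteq> {}"
    unfolding minimizers_def by force
  show eq: "a I + I \<bullet> y = ?m" if "I \<in> minimizers \<Delta> a y" for I
    using that by (simp add: minimizers_def trop_monomial_inner)
  show le: "?m \<le> a K + K \<bullet> y" if "K \<in> lattice_points \<Delta>" for K
    unfolding trop_eval_def trop_monomial_inner using assms that by (intro Min_le) auto
  show "?m < a K + K \<bullet> y" if "K \<in> lattice_points \<Delta> - minimizers \<Delta> a y" for K
    using le[of K] that by (force simp: minimizers_def trop_monomial_inner)
qed

lemma mem_trop_hypersurface_iff:
  assumes "finite (lattice_points \<Delta>)"
  shows "y \<in> trop_hypersurface \<Delta> a \<longleftrightarrow>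
    (\<exists>I \<in> minimizers \<Delta> a y. \<exists>J \<in> minimizers \<Delta> a y. I \<noteq> J)"
proof -
  have "finite (minimizers \<Delta> a y)"
    using assms minimizers_subset finite_subset by metis
  then have "card (minimizers \<Delta> a y) \<le> Suc 0 \<longleftrightarrow>
      (\<forall>I \<in> minimizers \<Delta> a y. \<forall>J \<in> minimizers \<Delta> a y. I = J)"
    by (rule card_le_Suc0_iff_eq)
  moreover have "y \<in> trop_hypersurface \<Delta> a \<longleftrightarrow> \<not> card (minimizers \<Delta> a y) \<le> Suc 0"
    unfolding trop_hypersurface_def by auto
  ultimately show ?thesis by blast
qed

text \<open>Moving from \<open>y\<close> a little in direction \<open>d\<close> selects, among the monomials minimal at \<open>y\<close>, those
  with least slope along \<open>d\<close>; by finiteness the others stay above.\<close>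

lemma minimizers_move_slightly:
  assumes fin: "finite (lattice_points \<Delta>)"
    and T: "T \<subseteq> minimizers \<Delta> a y" "T \<noteq> {}"
    and eq: "\<And>I. I \<in> T \<Longrightarrow> d \<bullet> I = c"
    and gt: "\<And>I. I \<in> minimizers \<Delta> a y - T \<Longrightarrow> c < d \<bullet> I"
  shows "\<exists>z. minimizers \<Delta> a z = T"
proof -
  have ne: "lattice_points \<Delta> \<noteq> {}"
    using T minimizers_subset by blast
  obtain m where m: "\<And>I. I \<in> minimizers \<Delta> a y \<Longrightarrow> a I + I \<bullet> y = m"
    and less: "\<And>K. K \<in> lattice_points \<Delta> - minimizers \<Delta> a y \<Longrightarrow> m < a K + K \<bullet> y"
    using minimum_value_exists[OF fin ne, of a y] by metis
  have "\<forall>\<^sub>F t in at_right 0. \<forall>K \<in> lattice_points \<Delta> - minimizers \<Delta> a y.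
      m + t * c < a K + K \<bullet> y + t * (d \<bullet> K)"
  proof (rule eventually_ball_finite, use fin in simp, intro ballI)
    fix K assume K: "K \<in> lattice_points \<Delta> - minimizers \<Delta> a y"
    have "((\<lambda>t. a K + K \<bullet> y + t * (d \<bullet> K) - (m + t * c)) \<longlongrightarrow>
        a K + K \<bullet> y + 0 * (d \<bullet> K) - (m + 0 * c)) (at_right 0)"
      by (intro tendsto_intros)
    moreover have "0 < a K + K \<bullet> y + 0 * (d \<bullet> K) - (m + 0 * c)"
      using less[OF K] by simp
    ultimately have "\<forall>\<^sub>F t in at_right 0. 0 < a K + K \<bullet> y + t * (d \<bullet> K) - (m + t * c)"
      by (rule order_tendstoD(1))
    then show "\<forall>\<^sub>F t in at_right 0. m + t * c < a K + K \<bullet> y + t * (d \<bullet> K)"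
      by (rule eventually_mono) simp
  qed
  then have "\<forall>\<^sub>F t in at_right 0. 0 < t \<and> (\<forall>K \<in> lattice_points \<Delta> - minimizers \<Delta> a y.
      m + t * c < a K + K \<bullet> y + t * (d \<bullet> K))"
    using eventually_at_right_less[of "0::real"] by (rule eventually_conj[rotated])
  then obtain t :: real where t: "0 < t" and
    far: "\<And>K. K \<in> lattice_points \<Delta> - minimizers \<Delta> a y \<Longrightarrow>
      m + t * c < a K + K \<bullet> y + t * (d \<bullet> K)"
    using eventually_happens'[OF trivial_limit_at_right_real] by blast
  have shift: "I \<bullet> (y + t *\<^sub>R d) = I \<bullet> y + t * (d \<bullet> I)" for I
    by (simp add: inner_add_right inner_commute)
  have "minimizers \<Delta> a (y + t *\<^sub>R d) = T"
  proof (rule minimizers_eqI[OF fin _ T(2)])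
    show "T \<subseteq> lattice_points \<Delta>"
      using T minimizers_subset by blast
    show "a I + I \<bullet> (y + t *\<^sub>R d) = m + t * c" if "I \<in> T" for I
      using that T(1) m[of I] eq[of I] by (auto simp: shift)
    show "m + t * c < a K + K \<bullet> (y + t *\<^sub>R d)" if "K \<in> lattice_points \<Delta> - T" for K
    proof (cases "K \<in> minimizers \<Delta> a y")
      case True
      then show ?thesis
        using that m[of K] mult_strict_left_mono[OF gt[of K] t] by (simp add: shift)
    next
      case False
      then show ?thesis
        using that far[of K] by (simp add: shift)
    qed
  qed
  then show ?thesis by blast
qed

text \<open>If all monomials minimal at \<open>y\<close> have slope \<open>c\<close> along \<open>d\<close> and some monomial has a smaller
  slope, then the first monomial of smaller slope to catch up along the ray \<open>y + t d\<close> joins them.\<close>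

lemma minimizers_grow_along_ray:
  assumes fin: "finite (lattice_points \<Delta>)"
    and eq: "\<And>I. I \<in> minimizers \<Delta> a y \<Longrightarrow> d \<bullet> I = c"
    and K0: "K0 \<in> lattice_points \<Delta>" "d \<bullet> K0 < c"
  shows "\<exists>z. minimizers \<Delta> a y \<subset> minimizers \<Delta> a z"
proof -
  have ne: "lattice_points \<Delta> \<noteq> {}"
    using K0 by blast
  obtain m where m: "\<And>I. I \<in> minimizers \<Delta> a y \<Longrightarrow> a I + I \<bullet> y = m"
    and le: "\<And>K. K \<in> lattice_points \<Delta> \<Longrightarrow> m \<le> a K + K \<bullet> y"
    using minimum_value_exists[OF fin ne, of a y] by metis
  let ?N = "{K \<in> lattice_points \<Delta>. d \<bullet> K < c}"
  (* the value of t at which the monomial K reaches the common value of the current minimizers *)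
  let ?time = "\<lambda>K. (a K + K \<bullet> y - m) / (c - d \<bullet> K)"
  define t where "t = Min (?time ` ?N)"
  have finN: "finite (?time ` ?N)"
    using fin by simp
  have "t \<in> ?time ` ?N"
    unfolding t_def using K0 by (intro Min_in finN) auto
  then obtain K1 where K1: "K1 \<in> lattice_points \<Delta>" "d \<bullet> K1 < c" "t = ?time K1"
    by blast
  have t_le: "t \<le> ?time K" if "K \<in> lattice_points \<Delta>" "d \<bullet> K < c" for K
    unfolding t_def using that by (intro Min_le finN) auto
  have t0: "0 \<le> t"
    using K1 le[of K1] by simp
  have shift: "I \<bullet> (y + t *\<^sub>R d) = I \<bullet> y + t * (d \<bullet> I)" for I
    by (simp add: inner_add_right inner_commute)
  have low: "m + t * c \<le> a K + K \<bullet> (y + t *\<^sub>R d)" if "K \<in> lattice_points \<Delta>" for K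
  proof (cases "d \<bullet> K < c")
    case True
    then have "t * (c - d \<bullet> K) \<le> a K + K \<bullet> y - m"
      using t_le[OF that True] by (simp add: pos_le_divide_eq)
    then show ?thesis unfolding shift right_diff_distrib by linarith
  next
    case False
    then have "t * c \<le> t * (d \<bullet> K)"
      using t0 by (simp add: mult_left_mono)
    then show ?thesis
      using le[OF that] by (simp add: shift)
  qed
  have "t * (c - d \<bullet> K1) = a K1 + K1 \<bullet> y - m"
    using K1 by simp
  then have "a K1 + K1 \<bullet> (y + t *\<^sub>R d) = m + t * c"
    unfolding shift right_diff_distrib by linarith
  then have "K1 \<in> minimizers \<Delta> a (y + t *\<^sub>R d)"
    using K1 low by (simp add: mem_minimizers_iff[OF fin])
  moreover have "I \<in> minimizers \<Delta> a (y + t *\<^sub>R d)" if "I \<in> minimizers \<Delta> a y" for I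
  proof -
    have "a I + I \<bullet> (y + t *\<^sub>R d) = m + t * c"
      using m[OF that] eq[OF that] by (simp add: shift)
    then show ?thesis
      using that low minimizers_subset[of \<Delta> a y] by (auto simp: mem_minimizers_iff[OF fin])
  qed
  moreover have "K1 \<notin> minimizers \<Delta> a y"
    using eq[of K1] K1 by auto
  ultimately show ?thesis by blast
qed

text \<open>Every cell of the dual complex is contained in a full-dimensional one: a maximal set of
  minimizers cannot lie in a hyperplane, since otherwise it would grow along one of the two
  normal directions.\<close>

lemma minimizers_subset_full_dim:
  fixes \<Delta> :: "(real ^ 'n) set"
  assumes lp: "lattice_polytope \<Delta>" and dim: "aff_dim \<Delta> = int CARD('n)"
  shows "\<exists>z. minimizers \<Delta> a y \<subseteq> minimizers \<Delta> a z \<and> aff_dim (minimizers \<Delta> a z) = int CARD('n)"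
proof -
  obtain V where V: "finite V" "V \<subseteq> integer_points" "\<Delta> = convex hull V"
    using lp by (auto simp: lattice_polytope_def)
  have fin: "finite (lattice_points \<Delta>)"
    by (rule finite_lattice_points[OF bounded_lattice_polytope[OF lp]])
  have VL: "V \<subseteq> lattice_points \<Delta>"
    using V by (auto simp: lattice_points_def hull_inc)
  let ?C = "(\<lambda>z. minimizers \<Delta> a z) ` {z. minimizers \<Delta> a y \<subseteq> minimizers \<Delta> a z}"
  have "finite ?C"
    by (rule finite_subset[of _ "Pow (lattice_points \<Delta>)"]) (use fin minimizers_subset in auto)
  moreover have "?C \<noteq> {}" by blast
  ultimately obtain B where "B \<in> ?C" and max: "\<And>B'. B' \<in> ?C \<Longrightarrow> B \<subseteq> B' \<Longrightarrow> B = B'"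
    by (meson finite_has_maximal)
  then obtain z where z: "minimizers \<Delta> a y \<subseteq> minimizers \<Delta> a z" "B = minimizers \<Delta> a z"
    by blast
  have maxz: "\<not> minimizers \<Delta> a z \<subset> minimizers \<Delta> a w" for w
    using max[of "minimizers \<Delta> a w"] z by blast
  have "\<not> aff_dim (minimizers \<Delta> a z) < int CARD('n)"
  proof
    assume "aff_dim (minimizers \<Delta> a z) < int CARD('n)"
    then obtain d c where d: "d \<noteq> 0" "minimizers \<Delta> a z \<subseteq> {x. d \<bullet> x = c}"
      using aff_lowdim_subset_hyperplane[of "minimizers \<Delta> a z"] by auto
    have "\<not> lattice_points \<Delta> \<subseteq> {x. d \<bullet> x = c}"
    proof
      assume "lattice_points \<Delta> \<subseteq> {x. d \<bullet> x = c}"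
      then have "\<Delta> \<subseteq> {x. d \<bullet> x = c}"
        using V(3) VL by (simp add: hull_minimal convex_hyperplane)
      then have "aff_dim \<Delta> \<le> aff_dim {x. d \<bullet> x = c}"
        by (rule aff_dim_subset)
      then show False
        using dim d(1) by (simp add: aff_dim_hyperplane)
    qed
    then obtain K where K: "K \<in> lattice_points \<Delta>" "d \<bullet> K \<noteq> c"
      by blast
    then have "d \<bullet> K < c \<or> (- d) \<bullet> K < - c"
      by auto
    then show False
      using K(1) minimizers_grow_along_ray[OF fin, of a z d c K]
        minimizers_grow_along_ray[OF fin, of a z "- d" "- c" K] maxz d(2)
      by (auto simp: subset_iff)
  qed
  moreover have "aff_dim (minimizers \<Delta> a z) \<le> int CARD('n)"
    using aff_dim_le_DIM[of "minimizers \<Delta> a z"] by simp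
  ultimately show ?thesis
    using z by (metis order_le_less)
qed

section \<open>Dual complexes with simplices as cells\<close>

text \<open>A full-dimensional lattice polytope contains at least \<open>n + 1\<close> lattice points, namely its
  vertices, so equality says that every full-dimensional cell is a simplex whose only lattice points
  are its vertices.\<close>

locale simplicial_dual_complex =
  fixes \<Delta> :: "(real ^ 'n) set" and a :: "real ^ 'n \<Rightarrow> real"
  assumes lattice_polytope: "lattice_polytope \<Delta>"
    and full_dim: "aff_dim \<Delta> = int CARD('n)"
    and cells: "\<And>P. P \<in> dual_complex \<Delta> a \<Longrightarrow> aff_dim P = int CARD('n) \<Longrightarrow>
      card (lattice_points P) = CARD('n) + 1"
begin

lemma finite_points: "finite (lattice_points \<Delta>)"
  by (rule finite_lattice_points[OF bounded_lattice_polytope[OF lattice_polytope]])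

lemma points_nonempty: "lattice_points \<Delta> \<noteq> {}"
proof
  assume "lattice_points \<Delta> = {}"
  moreover obtain V where "V \<subseteq> integer_points" "\<Delta> = convex hull V"
    using lattice_polytope by (auto simp: lattice_polytope_def)
  ultimately have "V = {}"
    using hull_inc[of _ V convex] by (auto simp: lattice_points_def)
  then show False
    using full_dim \<open>\<Delta> = convex hull V\<close> by simp
qed

text \<open>Minimizers that span a full-dimensional cell span the space and, being lattice points of the
  cell, number at most \<open>n + 1\<close>, so they are independent. Any other set of minimizers is part of
  such a set.\<close>

lemma minimizers_affine_independent: "\<not> affine_dependent (minimizers \<Delta> a y)"
proof -
  obtain z where z: "minimizers \<Delta> a y \<subseteq> minimizers \<Delta> a z"
      "aff_dim (minimizers \<Delta> a z) = int CARD('n)"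
    using minimizers_subset_full_dim[OF lattice_polytope full_dim] by blast
  let ?B = "minimizers \<Delta> a z"
  have fB: "finite ?B"
    using finite_points minimizers_subset finite_subset by metis
  have "card (lattice_points (convex hull ?B)) = CARD('n) + 1"
    by (rule cells) (auto simp: dual_complex_def aff_dim_convex_hull z(2))
  moreover have "?B \<subseteq> lattice_points (convex hull ?B)"
    using minimizers_subset[of \<Delta> a z] by (auto simp: lattice_points_def hull_inc)
  ultimately have "card ?B \<le> CARD('n) + 1"
    by (metis card.infinite card_mono add_is_0 one_neq_zero)
  moreover have "aff_dim ?B \<le> int (card ?B) - 1"
    using aff_dim_le_card[OF fB] by simp
  ultimately have "\<not> affine_dependent ?B"
    using z(2) fB by (simp add: affine_independent_iff_card)
  then show ?thesis
    using z(1) affine_dependent_subset by blast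
qed

text \<open>Each subset of an affinely independent set of minimizers spans a face of a simplex, and a
  linear functional exposing this face gives a direction in which exactly the subset stays minimal.\<close>

lemma minimizers_subset_realized:
  assumes T: "T \<subseteq> minimizers \<Delta> a y" "T \<noteq> {}"
  shows "\<exists>z. minimizers \<Delta> a z = T"
proof -
  let ?B = "minimizers \<Delta> a y"
  note indep = minimizers_affine_independent[of y]
  have fB: "finite ?B"
    by (rule aff_independent_finite[OF indep])
  have "(convex hull T) face_of (convex hull ?B)"
    using face_of_convex_hull_affine_independent[OF indep] T(1) by blast
  then have "(convex hull T) exposed_face_of (convex hull ?B)"
    using exposed_face_of_polyhedron polyhedron_convex_hull[OF fB] by blast
  then obtain d c where dc: "convex hull ?B \<subseteq> {x. d \<bullet> x \<le> c}"
      "convex hull T = convex hull ?B \<inter> {x. d \<bullet> x = c}"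
    unfolding exposed_face_of_def by blast
  have notin: "I \<notin> convex hull T" if "I \<in> ?B - T" for I
  proof
    assume "I \<in> convex hull T"
    moreover have "T \<subseteq> ?B - {I}"
      using that T(1) by blast
    ultimately have "I \<in> affine hull (?B - {I})"
      using hull_mono[of T "?B - {I}" convex] convex_hull_subset_affine_hull by blast
    then show False
      using that indep unfolding affine_dependent_def by blast
  qed
  show ?thesis
  proof (rule minimizers_move_slightly[OF finite_points T, of "- d" "- c"])
    show "- d \<bullet> I = - c" if "I \<in> T" for I
    proof -
      have "I \<in> convex hull T" using that by (rule hull_inc)
      then show ?thesis unfolding dc(2) by simp
    qed
    show "- c < - d \<bullet> I" if "I \<in> ?B - T" for I
    proof -
      have "I \<in> convex hull ?B" using that by (simp add: hull_inc)
      moreover from this have "d \<bullet> I \<le> c"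
        using dc(1) by blast
      moreover have "d \<bullet> I \<noteq> c"
        using notin[OF that] \<open>I \<in> convex hull ?B\<close> unfolding dc(2) by simp
      ultimately show ?thesis by simp
    qed
  qed
qed

lemma minimizers_eq_of_hull_eq:
  assumes "convex hull (minimizers \<Delta> a y) = convex hull (minimizers \<Delta> a z)"
  shows "minimizers \<Delta> a y = minimizers \<Delta> a z"
proof -
  have "minimizers \<Delta> a x = {v. v extreme_point_of convex hull (minimizers \<Delta> a x)}" for x
    by (simp add: extreme_point_of_convex_hull_affine_independent minimizers_affine_independent)
  then show ?thesis
    using assms by metis
qed

text \<open>By affine independence a cell determines its minimizers, as the extreme points. The set of \<open>y\<close>
  with prescribed minimizers is cut out by linear equations and strict
  inequalities, so it is convex and contains the relative interior of its closure.\<close>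

lemma rel_interior_dual_polyhedron_subset:
  assumes "P \<in> dual_complex \<Delta> a" and "p \<in> rel_interior (dual_polyhedron \<Delta> a P)"
  shows "convex hull (minimizers \<Delta> a p) = P"
proof -
  obtain z where z: "P = convex hull (minimizers \<Delta> a z)"
    using assms(1) by (auto simp: dual_complex_def)
  let ?C = "{y. convex hull (minimizers \<Delta> a y) = P}"
  have C: "?C = {y. minimizers \<Delta> a y = minimizers \<Delta> a z}"
    unfolding z using minimizers_eq_of_hull_eq by auto
  have "convex ?C"
    unfolding C
  proof (rule convexI, clarify)
    fix u v :: real and x y
    assume x: "minimizers \<Delta> a x = minimizers \<Delta> a z" and y: "minimizers \<Delta> a y = minimizers \<Delta> a z"
      and uv: "0 \<le> u" "0 \<le> v" "u + v = 1"
    obtain m where ne: "minimizers \<Delta> a z \<noteq> {}"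
      and m: "\<And>I. I \<in> minimizers \<Delta> a z \<Longrightarrow> a I + I \<bullet> x = m"
        "\<And>K. K \<in> lattice_points \<Delta> - minimizers \<Delta> a z \<Longrightarrow> m < a K + K \<bullet> x"
      using minimum_value_exists[OF finite_points points_nonempty, of a x] x by metis
    obtain m' where
      m': "\<And>I. I \<in> minimizers \<Delta> a z \<Longrightarrow> a I + I \<bullet> y = m'"
        "\<And>K. K \<in> lattice_points \<Delta> - minimizers \<Delta> a z \<Longrightarrow> m' < a K + K \<bullet> y"
      using minimum_value_exists[OF finite_points points_nonempty, of a y] y by metis
    have comb: "a I + I \<bullet> (u *\<^sub>R x + v *\<^sub>R y) = u * (a I + I \<bullet> x) + v * (a I + I \<bullet> y)" for I
    proof -
      have "a I = u * a I + v * a I"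
        using uv(3) by (metis distrib_right mult_1)
      then show ?thesis by (simp add: inner_add_right algebra_simps)
    qed
    show "minimizers \<Delta> a (u *\<^sub>R x + v *\<^sub>R y) = minimizers \<Delta> a z"
    proof (rule minimizers_eqI[OF finite_points minimizers_subset ne])
      show "a I + I \<bullet> (u *\<^sub>R x + v *\<^sub>R y) = u * m + v * m'" if "I \<in> minimizers \<Delta> a z" for I
        unfolding comb using m(1)[OF that] m'(1)[OF that] by simp
      show "u * m + v * m' < a K + K \<bullet> (u *\<^sub>R x + v *\<^sub>R y)"
        if "K \<in> lattice_points \<Delta> - minimizers \<Delta> a z" for K
      proof (cases "u = 0")
        case True
        then show ?thesis
          unfolding comb using uv m'(2)[OF that] by simp
      next
        case False
        then have "u * m < u * (a K + K \<bullet> x)"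
          using uv m(2)[OF that] by simp
        moreover have "v * m' \<le> v * (a K + K \<bullet> y)"
          using uv m'(2)[OF that] by (simp add: mult_left_mono)
        ultimately show ?thesis
          unfolding comb by linarith
      qed
    qed
  qed
  then have "rel_interior (dual_polyhedron \<Delta> a P) = rel_interior ?C"
    unfolding dual_polyhedron_def by (rule convex_rel_interior_closure)
  then show ?thesis
    using assms(2) rel_interior_subset by blast
qed

text \<open>Any bipartition of the lattice points is crossed by a cell with two vertices. The regions
  where some exponent of \<open>S\<close>, respectively of its complement, is minimal are closed and cover the
  connected space \<open>\<real>\<^sup>n\<close>, so they meet; a pair of minimizers at a common point can be isolated.\<close>

lemma crossing_edge_exists:
  assumes sat: "saturated \<Delta> a"
    and S: "S \<subseteq> lattice_points \<Delta>" "S \<noteq> {}" "S \<noteq> lattice_points \<Delta>"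
  obtains y I J where "I \<in> S" "J \<in> lattice_points \<Delta> - S" "minimizers \<Delta> a y = {I, J}"
proof -
  let ?R = "\<lambda>I. {y. I \<in> minimizers \<Delta> a y}"
  have "?R I = (\<Inter>K \<in> lattice_points \<Delta>. {y. a I + I \<bullet> y \<le> a K + K \<bullet> y})"
    if "I \<in> lattice_points \<Delta>" for I
    using that by (auto simp: mem_minimizers_iff[OF finite_points])
  then have closed: "closed (?R I)" if "I \<in> lattice_points \<Delta>" for I
    using that by (auto intro!: closed_INT closed_Collect_le continuous_intros)
  let ?A = "\<Union>I \<in> S. ?R I" and ?B = "\<Union>J \<in> lattice_points \<Delta> - S. ?R J"
  have "closed ?A" "closed ?B"
    using S finite_points by (auto intro!: closed_UN closed intro: finite_subset)
  moreover have "UNIV \<subseteq> ?A \<union> ?B"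
  proof
    fix y
    obtain I where "I \<in> minimizers \<Delta> a y"
      using minimum_value_exists[OF finite_points points_nonempty, of a y] by (metis ex_in_conv)
    then show "y \<in> ?A \<union> ?B"
      using minimizers_subset[of \<Delta> a y] by blast
  qed
  moreover have "?A \<noteq> {}" "?B \<noteq> {}"
    using S sat unfolding saturated_def by blast+
  ultimately have "?A \<inter> ?B \<noteq> {}"
    using connected_closedD[OF connected_UNIV, of ?A ?B] by auto
  then obtain z I J where "I \<in> S" "J \<in> lattice_points \<Delta> - S"
      "I \<in> minimizers \<Delta> a z" "J \<in> minimizers \<Delta> a z"
    by blast
  then show ?thesis
    using that minimizers_subset_realized[of "{I, J}" z] by auto
qed

end

section \<open>Raising the coefficients of a set of exponents\<close>

text \<open>Adding a small \<open>\<epsilon>\<close> to the coefficients in \<open>S\<close> does not change the minimizers at a point where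
  these lie all inside or all outside \<open>S\<close>, because the gap to the other monomials is positive.\<close>

lemma eventually_minimizers_raise:
  assumes fin: "finite (lattice_points \<Delta>)" and ne: "lattice_points \<Delta> \<noteq> {}"
    and y: "minimizers \<Delta> a y \<subseteq> S \<or> minimizers \<Delta> a y \<inter> S = {}"
  shows "\<forall>\<^sub>F \<epsilon> in at_right 0.
    minimizers \<Delta> (\<lambda>I. if I \<in> S then a I + \<epsilon> else a I) y = minimizers \<Delta> a y"
proof -
  obtain m where B: "minimizers \<Delta> a y \<noteq> {}"
    and m: "\<And>I. I \<in> minimizers \<Delta> a y \<Longrightarrow> a I + I \<bullet> y = m"
    and less: "\<And>K. K \<in> lattice_points \<Delta> - minimizers \<Delta> a y \<Longrightarrow> m < a K + K \<bullet> y"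
    using minimum_value_exists[OF fin ne, of a y] by metis
  have "\<forall>\<^sub>F \<epsilon> in at_right 0. \<forall>K \<in> lattice_points \<Delta> - minimizers \<Delta> a y. \<epsilon> < a K + K \<bullet> y - m"
  proof (rule eventually_ball_finite, use fin in simp, intro ballI)
    fix K assume "K \<in> lattice_points \<Delta> - minimizers \<Delta> a y"
    then have "0 < a K + K \<bullet> y - m"
      using less by simp
    then show "\<forall>\<^sub>F \<epsilon> in at_right 0. \<epsilon> < a K + K \<bullet> y - m"
      by (rule eventually_mono[OF eventually_at_right_real]) simp
  qed
  moreover have "\<forall>\<^sub>F \<epsilon>::real in at_right 0. 0 < \<epsilon>"
    by (rule eventually_at_right_less)
  ultimately show ?thesis
  proof eventually_elim
    case (elim \<epsilon>)
    let ?m = "if minimizers \<Delta> a y \<subseteq> S then m + \<epsilon> else m"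
    show ?case
    proof (rule minimizers_eqI[OF fin minimizers_subset B, where m = ?m])
      show "(if I \<in> S then a I + \<epsilon> else a I) + I \<bullet> y = ?m" if "I \<in> minimizers \<Delta> a y" for I
        using that y m[OF that] by auto
      show "?m < (if K \<in> S then a K + \<epsilon> else a K) + K \<bullet> y"
        if "K \<in> lattice_points \<Delta> - minimizers \<Delta> a y" for K
        using bspec[OF elim(1) that] elim(2) less[OF that] by auto
    qed
  qed
qed

text \<open>A cut \<open>S\<close> that separates no minimizers at the points of \<open>F\<close> produces a second hypersurface
  through \<open>F\<close>. Each exponent is the only minimizer at some point, and these points certify that the
  raised polynomial is still saturated. At a point dual to an edge crossing the cut, raising
  leaves a single minimizer, so the hypersurface has moved.\<close>

lemma (in simplicial_dual_complex) other_hypersurface_exists: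
  assumes sat: "saturated \<Delta> a"
    and S: "S \<subseteq> lattice_points \<Delta>" "S \<noteq> {}" "S \<noteq> lattice_points \<Delta>"
    and F: "finite F" "F \<subseteq> trop_hypersurface \<Delta> a"
    and cut: "\<And>p. p \<in> F \<Longrightarrow> minimizers \<Delta> a p \<subseteq> S \<or> minimizers \<Delta> a p \<inter> S = {}"
  shows "\<exists>Y. is_hypersurface \<Delta> Y \<and> F \<subseteq> Y \<and> Y \<noteq> trop_hypersurface \<Delta> a"
proof -
  have "\<exists>y. minimizers \<Delta> a y = {I}" if I: "I \<in> lattice_points \<Delta>" for I
  proof -
    obtain y where "I \<in> minimizers \<Delta> a y"
      using sat I unfolding saturated_def by blast
    then show ?thesis
      using minimizers_subset_realized[of "{I}" y] by simp
  qed
  then obtain w where w: "\<And>I. I \<in> lattice_points \<Delta> \<Longrightarrow> minimizers \<Delta> a (w I) = {I}"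
    by metis
  obtain y I J where IJ: "I \<in> S" "J \<in> lattice_points \<Delta> - S" "minimizers \<Delta> a y = {I, J}"
    using crossing_edge_exists[OF sat S] by metis
  define b where "b = (\<lambda>\<epsilon> I. if I \<in> S then a I + \<epsilon> else a I)"
  have "\<forall>\<^sub>F \<epsilon> in at_right 0. \<forall>x \<in> F \<union> w ` lattice_points \<Delta>.
      minimizers \<Delta> (b \<epsilon>) x = minimizers \<Delta> a x"
    unfolding b_def
  proof (rule eventually_ball_finite, use F(1) finite_points in simp, intro ballI)
    fix x assume "x \<in> F \<union> w ` lattice_points \<Delta>"
    then have "minimizers \<Delta> a x \<subseteq> S \<or> minimizers \<Delta> a x \<inter> S = {}"
      using cut w by auto
    then show "\<forall>\<^sub>F \<epsilon> in at_right 0.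
        minimizers \<Delta> (\<lambda>I. if I \<in> S then a I + \<epsilon> else a I) x = minimizers \<Delta> a x"
      by (rule eventually_minimizers_raise[OF finite_points points_nonempty])
  qed
  then have "\<forall>\<^sub>F \<epsilon> in at_right 0. 0 < \<epsilon> \<and> (\<forall>x \<in> F \<union> w ` lattice_points \<Delta>.
      minimizers \<Delta> (b \<epsilon>) x = minimizers \<Delta> a x)"
    using eventually_at_right_less[of "0::real"] by (rule eventually_conj[rotated])
  then obtain \<epsilon> :: real where \<epsilon>: "0 < \<epsilon>" and
    same: "\<And>x. x \<in> F \<union> w ` lattice_points \<Delta> \<Longrightarrow> minimizers \<Delta> (b \<epsilon>) x = minimizers \<Delta> a x"
    using eventually_happens'[OF trivial_limit_at_right_real] by blast
  let ?Y = "trop_hypersurface \<Delta> (b \<epsilon>)"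
  have "saturated \<Delta> (b \<epsilon>)"
    unfolding saturated_def
  proof
    fix K assume "K \<in> lattice_points \<Delta>"
    then have "minimizers \<Delta> (b \<epsilon>) (w K) = {K}"
      using same[of "w K"] w[of K] by blast
    then show "\<exists>x. K \<in> minimizers \<Delta> (b \<epsilon>) x" by blast
  qed
  then have "is_hypersurface \<Delta> ?Y"
    unfolding is_hypersurface_def by blast
  moreover have "F \<subseteq> ?Y"
    using F(2) same unfolding trop_hypersurface_def by auto
  moreover have "y \<in> trop_hypersurface \<Delta> a"
    using IJ by (auto simp: mem_trop_hypersurface_iff[OF finite_points])
  moreover have "y \<notin> ?Y"
  proof -
    obtain m where m: "\<And>I. I \<in> minimizers \<Delta> a y \<Longrightarrow> a I + I \<bullet> y = m"
      and less: "\<And>K. K \<in> lattice_points \<Delta> - minimizers \<Delta> a y \<Longrightarrow> m < a K + K \<bullet> y"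
      using minimum_value_exists[OF finite_points points_nonempty, of a y] by metis
    have "minimizers \<Delta> (b \<epsilon>) y = {J}"
    proof (rule minimizers_eqI[OF finite_points])
      show "{J} \<subseteq> lattice_points \<Delta>" "{J} \<noteq> {}" using IJ by auto
      show "b \<epsilon> K + K \<bullet> y = m" if "K \<in> {J}" for K
        using that IJ m[of J] by (simp add: b_def)
      show "m < b \<epsilon> K + K \<bullet> y" if "K \<in> lattice_points \<Delta> - {J}" for K
        using that IJ \<epsilon> m[of I] less[of K] by (cases "K = I") (auto simp: b_def)
    qed
    then show ?thesis by (simp add: trop_hypersurface_def)
  qed
  ultimately show ?thesis by blast
qed

section \<open>Uniqueness from connectedness\<close>

text \<open>A tropical analogue of Cramer's rule: where \<open>b - a\<close> is least, \<open>b\<close> stays as low as possible.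
  If \<open>p\<close> has exactly the minimizers \<open>I\<close> and \<open>J\<close> for \<open>a\<close>, and \<open>b - a\<close> is least at \<open>I\<close>, then \<open>I\<close> is
  minimal for \<open>b\<close> at \<open>p\<close>, and a second minimizer for \<open>b\<close> must be minimal for \<open>a\<close> too and have least
  \<open>b - a\<close>; it can only be \<open>J\<close>.\<close>

lemma least_difference_propagates:
  assumes fin: "finite (lattice_points \<Delta>)"
    and p: "minimizers \<Delta> a p = {I, J}" "p \<in> trop_hypersurface \<Delta> b"
    and le: "\<And>K. K \<in> lattice_points \<Delta> \<Longrightarrow> b I - a I \<le> b K - a K"
  shows "b J - a J = b I - a I"
proof -
  have I: "I \<in> lattice_points \<Delta>"
    using p(1) minimizers_subset[of \<Delta> a p] by auto
  obtain K where K: "K \<in> minimizers \<Delta> b p" "K \<noteq> I"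
    using p(2) by (auto simp: mem_trop_hypersurface_iff[OF fin])
  then have KL: "K \<in> lattice_points \<Delta>" and "b K + K \<bullet> p \<le> b I + I \<bullet> p"
    using I by (auto simp: mem_minimizers_iff[OF fin])
  moreover have aI: "\<And>M. M \<in> lattice_points \<Delta> \<Longrightarrow> a I + I \<bullet> p \<le> a M + M \<bullet> p"
    using p(1) mem_minimizers_iff[OF fin, of I a p] by blast
  ultimately have "a K + K \<bullet> p \<le> a I + I \<bullet> p" and eq: "b K - a K = b I - a I"
    using le[OF KL] aI[OF KL] by linarith+
  then have "K \<in> minimizers \<Delta> a p"
    unfolding mem_minimizers_iff[OF fin] using KL aI
    by (intro conjI ballI) (auto intro: order_trans[of _ "a I + I \<bullet> p"])
  then show ?thesis
    using p(1) K(2) eq by auto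
qed

lemma trop_hypersurface_cong_const:
  assumes fin: "finite (lattice_points \<Delta>)"
    and "\<And>I. I \<in> lattice_points \<Delta> \<Longrightarrow> b I = a I + c"
  shows "trop_hypersurface \<Delta> b = trop_hypersurface \<Delta> a"
proof -
  have "minimizers \<Delta> b y = minimizers \<Delta> a y" for y
    using assms(2) by (auto simp: mem_minimizers_iff[OF fin])
  then show ?thesis by (simp add: trop_hypersurface_def)
qed

section \<open>Connectedness and cuts\<close>

text \<open>Connectedness enters the argument only through sets of vertices that no arc leaves or enters.
  The vertices reachable from a given one form such a set.\<close>

lemma connected_iff_no_cut:
  assumes ne: "pverts G \<noteq> {}" and arcs: "parcs G \<subseteq> pverts G \<times> pverts G"
  shows "Digraph_Component.connected (with_proj G) \<longleftrightarrow>
    (\<forall>S \<subseteq> pverts G. S \<noteq> {} \<and> (\<forall>(u, v) \<in> parcs G. u \<in> S \<longleftrightarrow> v \<in> S) \<longrightarrow> S = pverts G)"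
    (is "?L \<longleftrightarrow> ?R")
proof -
  let ?reach = "rtrancl_on (pverts G) (parcs G \<union> (parcs G)\<inverse>)"
  have sym: "parcs (mk_symmetric (with_proj G)) = parcs G \<union> (parcs G)\<inverse>"
    by (auto simp: parcs_mk_symmetric)
  have conn: "?L \<longleftrightarrow> (\<forall>u \<in> pverts G. \<forall>v \<in> pverts G. (u, v) \<in> ?reach)"
    using ne by (simp add: Digraph_Component.connected_def strongly_connected_def reachable_def sym)
  show ?thesis
  proof
    assume L: ?L
    show ?R
    proof (intro allI impI)
      fix S assume S: "S \<subseteq> pverts G"
        and cut: "S \<noteq> {} \<and> (\<forall>(u, v) \<in> parcs G. u \<in> S \<longleftrightarrow> v \<in> S)"
      then obtain u where u: "u \<in> S" by blast
      have "v \<in> S" if "(u, v) \<in> ?reach" for v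
        using that
      proof (induction rule: rtrancl_on_induct)
        case (step x y)
        then show ?case using cut by blast
      qed (rule u)
      then show "S = pverts G"
        using L[unfolded conn] u S by blast
    qed
  next
    assume R: ?R
    show ?L
      unfolding conn
    proof (intro ballI)
      fix u v assume uv: "u \<in> pverts G" "v \<in> pverts G"
      let ?S = "{v \<in> pverts G. (u, v) \<in> ?reach}"
      have "x \<in> ?S \<longleftrightarrow> y \<in> ?S" if "(x, y) \<in> parcs G" for x y
      proof -
        have "(x, y) \<in> parcs G \<union> (parcs G)\<inverse>" "(y, x) \<in> parcs G \<union> (parcs G)\<inverse>"
          and "x \<in> pverts G" "y \<in> pverts G"
          using that arcs by auto
        then show ?thesis
          by (blast intro: rtrancl_on_into_rtrancl_on)
      qed
      moreover have "u \<in> ?S" using uv by simp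
      ultimately have "?S = pverts G"
        by (intro R[rule_format]) auto
      then show "(u, v) \<in> ?reach" using uv by blast
    qed
  qed
qed

section \<open>Plane curves\<close>

text \<open>An edge of the dual complex is a simplex, so its endpoints are its only minimizers: the arcs of
  the graph are exactly the pairs of exponents that are minimal at a common fixed point.\<close>

lemma parcs_marked_graph:
  assumes "simplicial_dual_complex \<Delta> a"
    and F: "\<forall>p \<in> F. \<exists>e \<in> curve_edges \<Delta> a. p \<in> rel_interior e"
  shows "parcs (marked_graph \<Delta> a F) = {(I, J). I \<noteq> J \<and> (\<exists>p \<in> F. minimizers \<Delta> a p = {I, J})}"
    and "p \<in> F \<Longrightarrow> \<exists>I J. I \<noteq> J \<and> minimizers \<Delta> a p = {I, J}"
proof -
  interpret simplicial_dual_complex \<Delta> a by fact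
  have pair: "minimizers \<Delta> a p = {I, J}"
    if "convex hull (minimizers \<Delta> a p) = closed_segment I J" for p I J
    using extreme_point_of_convex_hull_affine_independent[OF minimizers_affine_independent, of _ p]
    unfolding that extreme_point_of_segment by auto
  have edge: "\<exists>E \<in> dual_complex_edges \<Delta> a. convex hull (minimizers \<Delta> a p) = E \<and>
      p \<in> rel_interior (dual_polyhedron \<Delta> a E)" if "p \<in> F" for p
    using bspec[OF F that] rel_interior_dual_polyhedron_subset
    by (fastforce simp: curve_edges_def dual_complex_edges_def)
  show two: "\<exists>I J. I \<noteq> J \<and> minimizers \<Delta> a p = {I, J}" if "p \<in> F" for p
  proof -
    have "aff_dim (minimizers \<Delta> a p) = 1"
      using edge[OF that] by (auto simp: dual_complex_edges_def aff_dim_convex_hull)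
    then have "card (minimizers \<Delta> a p) = 2"
      using aff_dim_affine_independent[OF minimizers_affine_independent, of p] by simp
    then show ?thesis by (auto simp: card_2_iff)
  qed
  show "parcs (marked_graph \<Delta> a F) = {(I, J). I \<noteq> J \<and> (\<exists>p \<in> F. minimizers \<Delta> a p = {I, J})}"
  proof (intro equalityI subsetI; clarify)
    fix I J assume "(I, J) \<in> parcs (marked_graph \<Delta> a F)"
    then have "I \<noteq> J" and "closed_segment I J \<in> marked_edges \<Delta> a F"
      by (auto simp: marked_graph_def)
    then obtain p where "p \<in> F" "convex hull (minimizers \<Delta> a p) = closed_segment I J"
      using rel_interior_dual_polyhedron_subset
      by (fastforce simp: marked_edges_def dual_complex_edges_def)
    then show "I \<noteq> J \<and> (\<exists>p \<in> F. minimizers \<Delta> a p = {I, J})"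
      using pair \<open>I \<noteq> J\<close> by blast
  next
    fix I J p assume "I \<noteq> J" and p: "p \<in> F" "minimizers \<Delta> a p = {I, J}"
    then show "(I, J) \<in> parcs (marked_graph \<Delta> a F)"
      using edge[OF p(1)] by (auto simp: marked_graph_def marked_edges_def segment_convex_hull)
  qed
qed

theorem proposition1p1:
  fixes \<Delta> F X :: "(real ^ 2) set" and a :: "real ^ 2 \<Rightarrow> real"
  assumes "lattice_polytope \<Delta>" and "aff_dim \<Delta> = 2"
    and "saturated \<Delta> a"
    and "X = trop_hypersurface \<Delta> a"
    and "finite F" and "F \<subseteq> X"
    and "\<forall>p \<in> F. \<exists>e \<in> curve_edges \<Delta> a. p \<in> rel_interior e"
    and "\<forall>P \<in> dual_complex \<Delta> a. aff_dim P = 2 \<longrightarrow> card (lattice_points P) = 3"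
  shows "(\<forall>Y. is_hypersurface \<Delta> Y \<and> F \<subseteq> Y \<longrightarrow> Y = X)
     \<longleftrightarrow> Digraph_Component.connected (with_proj (marked_graph \<Delta> a F))"
proof -
  interpret simplicial_dual_complex \<Delta> a
    by unfold_locales (use assms in auto)
  let ?G = "marked_graph \<Delta> a F"
  note arcs = parcs_marked_graph(1)[OF simplicial_dual_complex_axioms assms(7)]
  note pair = parcs_marked_graph(2)[OF simplicial_dual_complex_axioms assms(7)]
  have verts: "pverts ?G = lattice_points \<Delta>"
    by (simp add: marked_graph_def)
  have "parcs ?G \<subseteq> pverts ?G \<times> pverts ?G"
    unfolding verts arcs using minimizers_subset[of \<Delta> a] by auto
  then have conn: "Digraph_Component.connected (with_proj ?G) \<longleftrightarrow>
      (\<forall>S \<subseteq> lattice_points \<Delta>. S \<noteq> {} \<and> (\<forall>(I, J) \<in> parcs ?G. I \<in> S \<longleftrightarrow> J \<in> S)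
        \<longrightarrow> S = lattice_points \<Delta>)"
    using connected_iff_no_cut[of ?G] points_nonempty verts by simp
  show ?thesis
  proof
    assume uniq: "\<forall>Y. is_hypersurface \<Delta> Y \<and> F \<subseteq> Y \<longrightarrow> Y = X"
    show "Digraph_Component.connected (with_proj ?G)"
      unfolding conn
    proof (intro allI impI; rule ccontr)
      fix S assume S: "S \<subseteq> lattice_points \<Delta>"
        and cut: "S \<noteq> {} \<and> (\<forall>(I, J) \<in> parcs ?G. I \<in> S \<longleftrightarrow> J \<in> S)"
        and proper: "S \<noteq> lattice_points \<Delta>"
      have "minimizers \<Delta> a p \<subseteq> S \<or> minimizers \<Delta> a p \<inter> S = {}" if p: "p \<in> F" for p
      proof -
        obtain I J where IJ: "I \<noteq> J" "minimizers \<Delta> a p = {I, J}"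
          using pair[OF p] by blast
        then have "(I, J) \<in> parcs ?G"
          unfolding arcs using p by auto
        then show ?thesis
          using cut IJ by auto
      qed
      then obtain Y where "is_hypersurface \<Delta> Y" "F \<subseteq> Y" "Y \<noteq> X"
        using other_hypersurface_exists[OF assms(3) S _ proper assms(5)] cut assms(6)
        unfolding assms(4) by metis
      then show False
        using uniq by blast
    qed
  next
    assume connected: "Digraph_Component.connected (with_proj ?G)"
    show "\<forall>Y. is_hypersurface \<Delta> Y \<and> F \<subseteq> Y \<longrightarrow> Y = X"
    proof (intro allI impI, elim conjE)
      fix Y assume "is_hypersurface \<Delta> Y" and FY: "F \<subseteq> Y"
      then obtain b where b: "Y = trop_hypersurface \<Delta> b"
        by (auto simp: is_hypersurface_def)
      define c where "c = Min ((\<lambda>I. b I - a I) ` lattice_points \<Delta>)"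
      let ?S = "{I \<in> lattice_points \<Delta>. b I - a I = c}"
      have least: "c \<le> b I - a I" if "I \<in> lattice_points \<Delta>" for I
        unfolding c_def using that finite_points by (intro Min_le) auto
      have "c \<in> (\<lambda>I. b I - a I) ` lattice_points \<Delta>"
        unfolding c_def using finite_points points_nonempty by (intro Min_in) auto
      then have "?S \<noteq> {}" by auto
      have step: "J \<in> ?S" if p: "p \<in> F" "minimizers \<Delta> a p = {I, J}" and I: "I \<in> ?S" for p I J
      proof -
        have "b J - a J = b I - a I"
        proof (rule least_difference_propagates[OF finite_points p(2)])
          show "p \<in> trop_hypersurface \<Delta> b" using p(1) FY b by blast
          show "b I - a I \<le> b K - a K" if "K \<in> lattice_points \<Delta>" for K
            using least[OF that] I by simp
        qed
        then show ?thesis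
          using I p(2) minimizers_subset[of \<Delta> a p] by auto
      qed
      have "\<forall>(I, J) \<in> parcs ?G. I \<in> ?S \<longleftrightarrow> J \<in> ?S"
      proof (rule ballI, clarify)
        fix I J assume "(I, J) \<in> parcs ?G"
        then obtain p where "p \<in> F" "minimizers \<Delta> a p = {I, J}"
          unfolding arcs by auto
        then show "I \<in> ?S \<longleftrightarrow> J \<in> ?S"
          using step[of p I J] step[of p J I] by (auto simp only: insert_commute)
      qed
      then have "?S = lattice_points \<Delta>"
        using \<open>?S \<noteq> {}\<close> by (intro connected[unfolded conn, rule_format]) auto
      then have "b I = a I + c" if "I \<in> lattice_points \<Delta>" for I
        using that by force
      then show "Y = X"
        unfolding b assms(4) by (rule trop_hypersurface_cong_const[OF finite_points])
    qed
  qed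
qed

end
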